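(* Let $G=(V,E)$ be a graph. Then $\mathcal{D}(G;x)=\mathcal{P}(G;x)$ if and only if for every non-isolated vertex $u\in V$ there exists $v\in N(u)$ such that $N[v]\subseteq N[u]$.
   Context: Graphs are finite and simple; $n=|V|$. $N(v)$ is the set of neighbors of $v$ and $N[v]=N(v)\cup\{v\}$. For $S\subseteq V$: $S$ is a dominating set if every vertex is in $S$ or adjacent to a vertex of $S$; $S$ is a power dominating set if, after coloring $S$, coloring every neighbor of a vertex of $S$, and then repeatedly applying the forcing rule (a colored vertex with exactly one uncolored neighbor colors that neighbor) until no changes occur, all vertices are colored. $\mathcal{D}(G;x)=\sum_{i=1}^n d(G;i)x^i$ and $\mathcal{P}(G;x)=\sum_{i=1}^n p(G;i)x^i$, where $d(G;i)$ and $p(G;i)$ are the numbers of dominating sets and power dominating sets of $G$ of size $i$. *)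

theory Defs
  imports "Graph_Theory.Pair_Digraph" "HOL-Computational_Algebra.Polynomial"
begin

text \<open>
  A finite simple graph is a \<open>pair_graph\<close>: a finite, loop-free, symmetric digraph without
  parallel arcs. An edge \<open>{u, v}\<close> is the pair of arcs \<open>(u, v)\<close> and \<open>(v, u)\<close>.
\<close>

definition nbhd :: "'a pair_pre_digraph \<Rightarrow> 'a \<Rightarrow> 'a set" where
  "nbhd G v = {w \<in> pverts G. (v, w) \<in> parcs G}"

definition closed_nbhd :: "'a pair_pre_digraph \<Rightarrow> 'a \<Rightarrow> 'a set" where
  "closed_nbhd G v = insert v (nbhd G v)"

definition isolated_vertex :: "'a pair_pre_digraph \<Rightarrow> 'a \<Rightarrow> bool" where
  "isolated_vertex G v \<longleftrightarrow> v \<in> pverts G \<and> nbhd G v = {}"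

definition dominating_set :: "'a pair_pre_digraph \<Rightarrow> 'a set \<Rightarrow> bool" where
  "dominating_set G S \<longleftrightarrow>
     S \<subseteq> pverts G \<and> (\<forall>v\<in>pverts G. v \<in> S \<or> (\<exists>s\<in>S. v \<in> nbhd G s))"

text \<open>
  \<open>forcing_step G C C'\<close>: one application of the forcing rule turns the set \<open>C\<close> of colored
  vertices into \<open>C'\<close>.
\<close>

inductive forcing_step :: "'a pair_pre_digraph \<Rightarrow> 'a set \<Rightarrow> 'a set \<Rightarrow> bool"
  for G :: "'a pair_pre_digraph" where
  force: "u \<in> C \<Longrightarrow> nbhd G u - C = {w} \<Longrightarrow> forcing_step G C (insert w C)"

text \<open>
  The final coloring does not depend on the order in which the forcing rule is applied, and no
  step is possible once all vertices are colored. So the exhaustive process colors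
  all vertices exactly if some sequence of steps reaches the whole vertex set.
\<close>

definition power_dominating_set :: "'a pair_pre_digraph \<Rightarrow> 'a set \<Rightarrow> bool" where
  "power_dominating_set G S \<longleftrightarrow>
     S \<subseteq> pverts G \<and> (forcing_step G)\<^sup>*\<^sup>* (S \<union> (\<Union>s\<in>S. nbhd G s)) (pverts G)"

definition num_dominating :: "'a pair_pre_digraph \<Rightarrow> nat \<Rightarrow> nat" where
  "num_dominating G i = card {S. dominating_set G S \<and> card S = i}"

definition num_power_dominating :: "'a pair_pre_digraph \<Rightarrow> nat \<Rightarrow> nat" where
  "num_power_dominating G i = card {S. power_dominating_set G S \<and> card S = i}"

definition domination_poly :: "'a pair_pre_digraph \<Rightarrow> int poly" where
  "domination_poly G = (\<Sum>i = 1..card (pverts G). monom (int (num_dominating G i)) i)"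

definition power_domination_poly :: "'a pair_pre_digraph \<Rightarrow> int poly" where
  "power_domination_poly G = (\<Sum>i = 1..card (pverts G). monom (int (num_power_dominating G i)) i)"

end

theory Submission
  imports Defs
begin

text \<open>
  Every dominating set is power dominating, so the polynomials agree iff every power dominating
  set is dominating. If the condition fails at \<open>u\<close>, then the complement of \<open>N[u]\<close> dominates
  everything except \<open>u\<close>, and any neighbor of \<open>u\<close> forces \<open>u\<close>. Conversely, if \<open>S\<close> is not
  dominating, choose an undominated \<open>w\<close> with \<open>N[w]\<close> of minimal size; under the condition
  \<open>w\<close> has a neighbor \<open>v\<close> with \<open>N[v] = N[w]\<close>, and of two uncolored closed twins neither can
  ever be forced.
\<close>

lemma nbhd_subset_pverts: "nbhd G v \<subseteq> pverts G"
  by (auto simp: nbhd_def)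

lemma closed_nbhd_subset_pverts: "v \<in> pverts G \<Longrightarrow> closed_nbhd G v \<subseteq> pverts G"
  by (auto simp: closed_nbhd_def nbhd_def)

lemma (in pair_graph) nbhd_sym: "v \<in> nbhd G u \<Longrightarrow> u \<in> nbhd G v"
  using arcs_symmetric in_arcsD1 by (auto simp: nbhd_def)

lemma (in pair_graph) not_in_nbhd_self: "v \<notin> nbhd G v"
  using no_loops'[of v v] by (auto simp: nbhd_def)

text \<open>Puts domination in terms of the initial coloring used by
  \<open>power_dominating_set\<close>: a dominating set is one for which zero forcing steps
  suffice.\<close>

lemma dominating_set_iff_closed_nbhds:
  "dominating_set G S \<longleftrightarrow> S \<subseteq> pverts G \<and> S \<union> (\<Union>s\<in>S. nbhd G s) = pverts G"
  by (auto simp: dominating_set_def nbhd_def)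

lemma dominating_imp_power_dominating:
  "dominating_set G S \<Longrightarrow> power_dominating_set G S"
  by (simp add: dominating_set_iff_closed_nbhds power_dominating_set_def)

text \<open>While both twins are uncolored, the vertex that forces is a third one, and it sees both
  or neither. Seeing both, it would have two uncolored neighbors and could not force.\<close>

lemma forcing_preserves_uncolored_twins:
  assumes "(forcing_step G)\<^sup>*\<^sup>* C C'"
    and "v \<notin> C" and "w \<notin> C" and "v \<noteq> w"
    and twins: "\<And>u. u \<noteq> v \<Longrightarrow> u \<noteq> w \<Longrightarrow> v \<in> nbhd G u \<longleftrightarrow> w \<in> nbhd G u"
  shows "v \<notin> C' \<and> w \<notin> C'"
  using assms(1)
proof (induction rule: rtranclp_induct)
  case base
  then show ?case using assms by simp
next
  case (step D D')
  from step.hyps(2) obtain u x where u: "u \<in> D" "nbhd G u - D = {x}" "D' = insert x D"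
    by (auto elim: forcing_step.cases)
  have "u \<noteq> v" "u \<noteq> w" using u(1) step.IH by auto
  with twins have "v \<in> nbhd G u \<longleftrightarrow> w \<in> nbhd G u" by blast
  with step.IH u(2) have "v \<in> nbhd G u - D \<longleftrightarrow> w \<in> nbhd G u - D" by blast
  with u(2) \<open>v \<noteq> w\<close> have "x \<noteq> v" "x \<noteq> w" by auto
  with u(3) step.IH show ?case by simp
qed

lemma (in pair_graph) power_dominating_imp_dominating:
  assumes cond: "\<forall>u\<in>pverts G. \<not> isolated_vertex G u \<longrightarrow>
      (\<exists>v\<in>nbhd G u. closed_nbhd G v \<subseteq> closed_nbhd G u)"
    and pd: "power_dominating_set G S"
  shows "dominating_set G S"
proof (rule ccontr)
  assume nd: "\<not> dominating_set G S"
  define C where "C = S \<union> (\<Union>s\<in>S. nbhd G s)"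
  have S: "S \<subseteq> pverts G" and reach: "(forcing_step G)\<^sup>*\<^sup>* C (pverts G)"
    using pd by (auto simp: power_dominating_set_def C_def)
  have "C \<subseteq> pverts G" using S nbhd_subset_pverts[of G] by (auto simp: C_def)
  with nd S obtain w0 where "w0 \<in> pverts G - C"
    by (auto simp: dominating_set_iff_closed_nbhds C_def)
  \<comment> \<open>Minimality will turn the inclusion N[v] \<subseteq> N[w] into an
    equality.\<close>
  then obtain w where w: "w \<in> pverts G - C"
    and min: "\<And>y. y \<in> pverts G - C \<Longrightarrow> card (closed_nbhd G w) \<le> card (closed_nbhd G y)"
    using ex_has_least_nat[of "\<lambda>y. y \<in> pverts G - C" w0 "\<lambda>y. card (closed_nbhd G y)"] by blast
  \<comment> \<open>In this form, being outside \<open>C\<close> passes to every vertex whose closed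
    neighborhood is contained in N[w].\<close>
  have uncolored: "y \<in> C \<longleftrightarrow> closed_nbhd G y \<inter> S \<noteq> {}" for y
    using nbhd_sym by (auto simp: C_def closed_nbhd_def)
  \<comment> \<open>By symmetry an isolated vertex lies in no neighborhood, so no step can color it,
    whereas \<open>reach\<close> colors everything.\<close>
  have "\<not> isolated_vertex G w"
  proof
    assume "isolated_vertex G w"
    then have iso: "w \<notin> nbhd G u" for u using nbhd_sym by (auto simp: isolated_vertex_def)
    have "w \<notin> D" if "(forcing_step G)\<^sup>*\<^sup>* C D" for D
      using that
    proof (induction rule: rtranclp_induct)
      case base
      then show ?case using w by simp
    next
      case (step D D')
      then show ?case using iso by (auto elim!: forcing_step.cases)
    qed
    with reach w show False by blast
  qed
  with cond w obtain v where v: "v \<in> nbhd G w" "closed_nbhd G v \<subseteq> closed_nbhd G w" by blast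
  have "v \<in> pverts G" using v nbhd_subset_pverts[of G] by blast
  moreover have "v \<notin> C" using w v(2) uncolored[of v] uncolored[of w] by blast
  ultimately have "card (closed_nbhd G w) \<le> card (closed_nbhd G v)" using min by blast
  moreover have "finite (closed_nbhd G w)"
    using w closed_nbhd_subset_pverts[of w G] finite_subset pair_finite_verts by blast
  ultimately have eq: "closed_nbhd G v = closed_nbhd G w"
    using v(2) by (simp add: card_seteq)
  \<comment> \<open>Away from \<open>v\<close> and \<open>w\<close>, open and closed neighborhoods
    agree; symmetry then moves \<open>u\<close> to the other side.\<close>
  have twins: "v \<in> nbhd G u \<longleftrightarrow> w \<in> nbhd G u" if "u \<noteq> v" "u \<noteq> w" for u
  proof -
    have "u \<in> nbhd G v \<longleftrightarrow> u \<in> nbhd G w" using eq that by (auto simp: closed_nbhd_def)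
    then show ?thesis using nbhd_sym by blast
  qed
  have "v \<noteq> w" using v(1) not_in_nbhd_self by blast
  then have "w \<notin> pverts G"
    using forcing_preserves_uncolored_twins[OF reach \<open>v \<notin> C\<close> _ _ twins] w by blast
  with w show False by blast
qed

text \<open>Each neighbor of \<open>u\<close> has a neighbor outside N[u], that is, in
  \<open>S\<close>, so only \<open>u\<close> is left to be forced. Nonemptiness of \<open>S\<close>
  is recorded because the polynomials count only sets of positive size.\<close>

lemma (in pair_graph) complement_closed_nbhd_power_dominating:
  assumes u: "u \<in> pverts G" and "\<not> isolated_vertex G u"
    and outside: "\<And>v. v \<in> nbhd G u \<Longrightarrow> \<not> closed_nbhd G v \<subseteq> closed_nbhd G u"
  defines "S \<equiv> pverts G - closed_nbhd G u"
  shows "S \<noteq> {}" and "power_dominating_set G S" and "\<not> dominating_set G S"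
proof -
  define C where "C = S \<union> (\<Union>s\<in>S. nbhd G s)"
  have nb: "\<exists>s\<in>S. v \<in> nbhd G s" if v: "v \<in> nbhd G u" for v
  proof -
    obtain s where s: "s \<in> closed_nbhd G v" "s \<notin> closed_nbhd G u" using outside[OF v] by blast
    then have "s \<in> nbhd G v" using v by (auto simp: closed_nbhd_def)
    then have "s \<in> S" "v \<in> nbhd G s"
      using s nbhd_sym nbhd_subset_pverts[of G] by (auto simp: S_def)
    then show ?thesis by blast
  qed
  obtain v where v: "v \<in> nbhd G u" using assms(1,2) by (auto simp: isolated_vertex_def)
  then show "S \<noteq> {}" using nb by blast
  \<comment> \<open>A vertex of \<open>S\<close> adjacent to \<open>u\<close> would lie in N[u],
    which \<open>S\<close> avoids.\<close>
  have "u \<notin> C" using nbhd_sym by (auto simp: C_def S_def closed_nbhd_def)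
  then have C: "C = pverts G - {u}"
    using nb nbhd_subset_pverts[of G] by (auto simp: C_def S_def closed_nbhd_def)
  then show "\<not> dominating_set G S"
    using u by (auto simp: dominating_set_iff_closed_nbhds C_def)
  have "v \<in> C" using v nb by (auto simp: C_def)
  moreover have "nbhd G v - C = {u}"
    using nbhd_sym[OF v] nbhd_subset_pverts[of G] C by auto
  ultimately have "forcing_step G C (insert u C)" by (rule force)
  moreover have "insert u C = pverts G" using C u by blast
  ultimately show "power_dominating_set G S"
    by (auto simp: power_dominating_set_def C_def S_def)
qed

lemma domination_poly_eq_iff:
  "domination_poly G = power_domination_poly G \<longleftrightarrow>
     (\<forall>i\<in>{1..card (pverts G)}. num_dominating G i = num_power_dominating G i)"
proof -
  have coeff: "coeff (\<Sum>i = 1..n. monom (int (f i)) i) k = (if k \<in> {1..n} then int (f k) else 0)"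
    for f :: "nat \<Rightarrow> nat" and n k
    by (simp add: coeff_sum)
  show ?thesis
    unfolding domination_poly_def power_domination_poly_def poly_eq_iff coeff by auto
qed

text \<open>For each size, the dominating sets form a subfamily of the finite family of power
  dominating sets, so equal counts force equal families.\<close>

lemma (in pair_graph) domination_poly_eq_iff_sets:
  "domination_poly G = power_domination_poly G \<longleftrightarrow>
     (\<forall>S. S \<noteq> {} \<longrightarrow> power_dominating_set G S \<longrightarrow> dominating_set G S)"
  (is "?L \<longleftrightarrow> ?R")
proof
  assume L: ?L
  show ?R
  proof (intro allI impI)
    fix S assume S: "S \<noteq> {}" "power_dominating_set G S"
    let ?D = "{T. dominating_set G T \<and> card T = card S}"
    let ?P = "{T. power_dominating_set G T \<and> card T = card S}"
    have sub: "S \<subseteq> pverts G" using S by (simp add: power_dominating_set_def)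
    then have "finite S" using finite_subset pair_finite_verts by blast
    \<comment> \<open>The sums start at index 1, so \<open>S\<close> must be nonempty for its size
      to be among the compared coefficients.\<close>
    with sub S have "card S \<in> {1..card (pverts G)}"
      by (simp add: card_mono Suc_le_eq card_gt_0_iff)
    with L have "card ?D = card ?P"
      unfolding domination_poly_eq_iff num_dominating_def num_power_dominating_def by blast
    moreover have "?D \<subseteq> ?P" using dominating_imp_power_dominating by blast
    moreover have "?P \<subseteq> Pow (pverts G)" by (auto simp: power_dominating_set_def)
    then have "finite ?P" by (rule finite_subset) simp
    ultimately have "?D = ?P" by (simp add: card_subset_eq)
    with S show "dominating_set G S" by blast
  qed
next
  assume R: ?R
  have "{S. dominating_set G S \<and> card S = i} = {S. power_dominating_set G S \<and> card S = i}"
    if "i \<ge> 1" for i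
  proof -
    have "S \<noteq> {}" if "card S = i" for S :: "'a set" using that \<open>i \<ge> 1\<close> by auto
    with R dominating_imp_power_dominating show ?thesis by blast
  qed
  then show ?L
    unfolding domination_poly_eq_iff num_dominating_def num_power_dominating_def by simp
qed

theorem theorem13:
  fixes G :: "'a pair_pre_digraph"
  assumes "pair_graph G"
  shows "domination_poly G = power_domination_poly G \<longleftrightarrow>
    (\<forall>u\<in>pverts G. \<not> isolated_vertex G u \<longrightarrow>
       (\<exists>v\<in>nbhd G u. closed_nbhd G v \<subseteq> closed_nbhd G u))"
proof -
  interpret pair_graph G by fact
  show ?thesis (is "_ \<longleftrightarrow> ?cond")
    unfolding domination_poly_eq_iff_sets
  proof
    assume pd: "\<forall>S. S \<noteq> {} \<longrightarrow> power_dominating_set G S \<longrightarrow> dominating_set G S"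
    show ?cond
    proof (intro ballI impI, rule ccontr)
      fix u assume u: "u \<in> pverts G" "\<not> isolated_vertex G u"
        and "\<not> (\<exists>v\<in>nbhd G u. closed_nbhd G v \<subseteq> closed_nbhd G u)"
      then have "\<not> closed_nbhd G v \<subseteq> closed_nbhd G u" if "v \<in> nbhd G u" for v
        using that by blast
      \<comment> \<open>The complement of N[u] is a nonempty power dominating set that is not
        dominating, contradicting \<open>pd\<close>.\<close>
      note complement = complement_closed_nbhd_power_dominating[OF u this]
      show False
        using complement(3) pd[rule_format, OF complement(1,2)] by (rule notE)
    qed
  next
    assume ?cond
    then show "\<forall>S. S \<noteq> {} \<longrightarrow> power_dominating_set G S \<longrightarrow> dominating_set G S"
      using power_dominating_imp_dominating by blast
  qed
qed

end
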